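(* Let $r\ge1$ be an integer and let $V\in C^\infty(\mathbb T)$, $\mathbb T=\mathbb R/\mathbb Z$, satisfy $V\le0$, $V^{-1}(0)=\{0\}$, $V(x)=-x^{2r}$ for $|x|$ small (in the local coordinate centered at $0$), and suppose that $V$ has exactly one critical point other than $0$, which is a nondegenerate minimum. Let $a_*=\int_{\mathbb T}\sqrt{-2V(x)}\,\mathrm{d}x$, fix $0<a<a_*$, and for $\lambda>0$ let $u_\lambda$ be the viscosity solution of $$\lambda u_\lambda+\tfrac12(u_\lambda'+a)^2+V(x)=0\qquad\text{in }\mathbb T,$$ with $u_0=\lim_{\lambda\to0^+}u_\lambda$. Then there exists $C_r>0$ such that $$\|u_\lambda-u_0\|_\infty\ge C_r\lambda^{1/(2r-1)}$$ for all sufficiently small $\lambda>0$. If $r=1$, then $\|u_\lambda-u_0\|_\infty\asymp\lambda$ as $\lambda\to0^+$. If $r\ge2$, the estimate $\|u_\lambda-u_0\|_\infty=O(\lambda)$ fails.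
   Context: The Hamiltonian is $H_a(x,p)=\frac12(p+a)^2+V(x)$ on $T^*\mathbb T$; its critical value (the unique $c$ for which $H_a(x,u')=c$ has a viscosity solution on $\mathbb T$) is $0$, so the displayed equation is the discounted equation $\lambda u_\lambda+H_a(x,u_\lambda')=c(H_a)$. It is known that $u_\lambda$ converges uniformly as $\lambda\to0^+$; $u_0$ denotes the limit. The notation $f(\lambda)\asymp g(\lambda)$ means that $C^{-1}g(\lambda)\le f(\lambda)\le Cg(\lambda)$ for some constant $C\geq 1$ independent of $\lambda$ and all sufficiently small $\lambda>0$. The constant $C_r$ is independent of $\lambda$. *)

theory Defs
  imports "HOL-Analysis.Analysis" "HOL-Library.Periodic_Fun" "HOL-Library.Landau_Symbols"
begin

text \<open>
  Functions on \<open>\<real>/\<int>\<close> are represented by their 1-periodic lifts \<open>real \<Rightarrow> real\<close>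
  (predicate \<^const>\<open>periodic_fun_simple'\<close>). The point 0 of the torus corresponds to the set
  \<open>\<int>\<close>, and its local coordinate is the coordinate of the lift near 0.
\<close>

definition smooth :: "(real \<Rightarrow> real) \<Rightarrow> bool" where
  "smooth f \<longleftrightarrow> (\<forall>n. ((deriv ^^ n) f) differentiable_on UNIV)"

definition hamiltonian :: "(real \<Rightarrow> real) \<Rightarrow> real \<Rightarrow> real \<Rightarrow> real \<Rightarrow> real" where
  "hamiltonian V a x p = (p + a)\<^sup>2 / 2 + V x"

text \<open>
  Viscosity solutions of \<open>F x (u x) (u' x) = 0\<close> on the torus, for 1-periodic \<open>F\<close> and \<open>u\<close>.
  The maximum of \<open>u - \<phi>\<close> is local, so it makes no difference whether the test
  functions are required to be periodic.
\<close>

definition viscosity_subsolution ::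
  "(real \<Rightarrow> real \<Rightarrow> real \<Rightarrow> real) \<Rightarrow> (real \<Rightarrow> real) \<Rightarrow> bool" where
  "viscosity_subsolution F u \<longleftrightarrow>
     (\<forall>\<phi> x. \<phi> C1_differentiable_on UNIV \<longrightarrow>
        (\<forall>\<^sub>F y in nhds x. u y - \<phi> y \<le> u x - \<phi> x) \<longrightarrow> F x (u x) (deriv \<phi> x) \<le> 0)"

definition viscosity_supersolution ::
  "(real \<Rightarrow> real \<Rightarrow> real \<Rightarrow> real) \<Rightarrow> (real \<Rightarrow> real) \<Rightarrow> bool" where
  "viscosity_supersolution F u \<longleftrightarrow>
     (\<forall>\<phi> x. \<phi> C1_differentiable_on UNIV \<longrightarrow>
        (\<forall>\<^sub>F y in nhds x. u y - \<phi> y \<ge> u x - \<phi> x) \<longrightarrow> F x (u x) (deriv \<phi> x) \<ge> 0)"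

definition viscosity_solution ::
  "(real \<Rightarrow> real \<Rightarrow> real \<Rightarrow> real) \<Rightarrow> (real \<Rightarrow> real) \<Rightarrow> bool" where
  "viscosity_solution F u \<longleftrightarrow>
     continuous_on UNIV u \<and> periodic_fun_simple' u \<and>
     viscosity_subsolution F u \<and> viscosity_supersolution F u"

text \<open>Used only for continuous periodic functions, for which the supremum is over a bounded set.\<close>

definition sup_norm :: "(real \<Rightarrow> real) \<Rightarrow> real" where
  "sup_norm f = (SUP x. \<bar>f x\<bar>)"

definition asymp_at_zero :: "(real \<Rightarrow> real) \<Rightarrow> (real \<Rightarrow> real) \<Rightarrow> bool" where
  "asymp_at_zero f g \<longleftrightarrow>
     (\<exists>C\<ge>1. \<forall>\<^sub>F s in at_right 0. inverse C * g s \<le> f s \<and> f s \<le> C * g s)"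

end

(*
  Write \<rho> = sqrt (-2 V). A subsolution satisfies \<lambda> u \<le> -V pointwise, so at x = -t with
  t ^ (2 r - 1) proportional to \<lambda> it is at most a small multiple of t, whereas comparison with
  the critical subsolutions of slope -a + \<kappa> \<rho>, \<kappa> = a / a_*, gives u_0 (-t) \<ge> a t - o(t). This is
  the lower rate. For r = 1 the function \<rho> dominates the distance to the integers, so the explicit
  limit u_0 (x) = min (\<integral>_0^x (\<rho> - a), \<integral>_x^1 (\<rho> + a)) is bounded by K \<rho>. Shifting the slopes
  \<plusminus>\<rho> by a multiple of \<lambda> then absorbs the term \<lambda> u and produces barriers within O(\<lambda>) of u_0 on
  both sides.
*)

theory Submission
  imports Defs
begin

section \<open>Antiderivatives and test functions\<close>

lemma antiderivative_exists:
  fixes f :: "real \<Rightarrow> real"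
  assumes "continuous_on UNIV f"
  obtains F where "F 0 = 0" "\<And>x. (F has_real_derivative f x) (at x)"
proof -
  have "isCont f x" for x
    using assms by (simp add: continuous_on_eq_continuous_at)
  then obtain F where F: "\<And>x. (F has_vector_derivative f x) (at x)"
    using einterval_antiderivative[of "-\<infinity>" "\<infinity>" f] by auto
  have "((\<lambda>x. F x - F 0) has_real_derivative f x) (at x)" for x
    using F[of x] by (auto intro!: derivative_eq_intros simp: has_real_derivative_iff_has_vector_derivative)
  then show ?thesis
    by (intro that[of "\<lambda>x. F x - F 0"]) auto
qed

lemma increment_le:
  fixes F G :: "real \<Rightarrow> real"
  assumes "\<And>x. (F has_real_derivative f x) (at x)" "\<And>x. (G has_real_derivative g x) (at x)"
    and "p \<le> q" "\<And>x. p \<le> x \<Longrightarrow> x \<le> q \<Longrightarrow> f x \<le> g x"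
  shows "F q - F p \<le> G q - G p"
proof -
  have "G p - F p \<le> G q - F q"
  proof (rule DERIV_nonneg_imp_nondecreasing[OF \<open>p \<le> q\<close>])
    fix x assume "p \<le> x" "x \<le> q"
    then show "\<exists>y. ((\<lambda>x. G x - F x) has_real_derivative y) (at x) \<and> 0 \<le> y"
      using assms(4)[of x] by (intro exI[of _ "g x - f x"]) (auto intro!: DERIV_diff assms)
  qed
  then show ?thesis by simp
qed

lemma C1_differentiable_onI:
  fixes F :: "real \<Rightarrow> real"
  assumes "\<And>x. (F has_real_derivative f x) (at x)" "continuous_on UNIV f"
  shows "F C1_differentiable_on UNIV"
  unfolding C1_differentiable_on_def
  using assms by (auto simp: has_real_derivative_iff_has_vector_derivative)

text \<open>Both pieces vanish to first order at \<open>c\<close>, so the squared positive part is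
  C1. It serves as a one-sided penalty in test functions and as the building block of the smoothed
  positive part.\<close>

lemma has_real_derivative_max_square:
  "((\<lambda>x. (max 0 (x - c))\<^sup>2) has_real_derivative 2 * max 0 (x - c)) (at x)" for x c :: real
proof -
  have "((\<lambda>x. if x \<in> {..c} then 0 else (x - c)\<^sup>2) has_vector_derivative
      (if x \<in> {..c} then 0 else 2 * (x - c))) (at x within UNIV)"
    by (rule has_vector_derivative_If_within_closures[where T = "{c<..}"])
      (auto intro!: derivative_eq_intros simp flip: has_real_derivative_iff_has_vector_derivative)
  moreover have "(\<lambda>x. if x \<in> {..c} then 0 else (x - c)\<^sup>2) = (\<lambda>x. (max 0 (x - c))\<^sup>2)"
    by (auto simp: fun_eq_iff)
  moreover have "(if x \<in> {..c} then 0 else 2 * (x - c)) = 2 * max 0 (x - c)"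
    by auto
  ultimately show ?thesis
    by (simp add: has_real_derivative_iff_has_vector_derivative)
qed

section \<open>Comparison arguments\<close>

lemma supersolution_test:
  assumes "viscosity_supersolution F u" "\<And>x. (w has_real_derivative f x) (at x)" "continuous_on UNIV f"
    and "eventually (\<lambda>y. u y - w y \<ge> u x - w x) (nhds x)"
  shows "F x (u x) (f x) \<ge> 0"
proof -
  have "deriv w x = f x"
    using assms(2) by (rule DERIV_imp_deriv)
  then show ?thesis
    using assms C1_differentiable_onI[of w f] unfolding viscosity_supersolution_def by metis
qed

lemma subsolution_test:
  assumes "viscosity_subsolution F u" "\<And>x. (w has_real_derivative f x) (at x)" "continuous_on UNIV f"
    and "eventually (\<lambda>y. u y - w y \<le> u x - w x) (nhds x)"
  shows "F x (u x) (f x) \<le> 0"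
proof -
  have "deriv w x = f x"
    using assms(2) by (rule DERIV_imp_deriv)
  then show ?thesis
    using assms C1_differentiable_onI[of w f] unfolding viscosity_subsolution_def by metis
qed

text \<open>At a minimum of \<open>u - w\<close> over one period, \<open>w\<close> is itself a test
  function, and \<open>strict\<close> contradicts the supersolution inequality if \<open>u\<close>
  lies below \<open>w\<close> there. As \<open>w\<close> need not be periodic, its values and slopes
  at 0 and 1 are required to match.\<close>

lemma supersolution_ge:
  assumes super: "viscosity_supersolution F u"
    and cont: "continuous_on UNIV u" and per: "\<And>x. u (x + 1) = u x"
    and w: "\<And>x. (w has_real_derivative f x) (at x)" and f: "continuous_on UNIV f"
    and w01: "w 0 = w 1" and f01: "f 0 = f 1"
    and strict: "\<And>x z. 0 \<le> x \<Longrightarrow> x < 1 \<Longrightarrow> z < w x \<Longrightarrow> F x z (f x) < 0"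
    and x: "x \<in> {0..1}"
  shows "w x \<le> u x"
proof (rule ccontr)
  assume neg: "\<not> w x \<le> u x"
  have contw: "continuous_on A w" for A
    using w DERIV_isCont continuous_at_imp_continuous_on by blast
  have "continuous_on {0..1} (\<lambda>x. u x - w x)"
    using cont contw by (auto intro!: continuous_intros elim: continuous_on_subset)
  then obtain z0 where z0: "z0 \<in> {0..1}" "\<And>y. y \<in> {0..1} \<Longrightarrow> u z0 - w z0 \<le> u y - w y"
    using continuous_attains_inf[of "{0..1::real}" "\<lambda>x. u x - w x"] by force
  \<comment> \<open>A minimum at 1 is moved to 0, into the half-open period where
    \<open>strict\<close> applies.\<close>
  define z where "z = (if z0 = 1 then 0 else z0)"
  have "u 0 = u 1" using per[of 0] by simp
  then have z: "0 \<le> z" "z < 1" "\<And>y. y \<in> {0..1} \<Longrightarrow> u z - w z \<le> u y - w y"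
    using z0 w01 by (auto simp: z_def)
  have "F z (u z) (f z) < 0"
    using z(3)[OF x] neg z(1,2) by (intro strict) auto
  moreover have "F z (u z) (f z) \<ge> 0"
  proof (cases "z = 0")
    case False
    then have "eventually (\<lambda>y. y \<in> {0<..<1}) (nhds z)"
      using z by (intro eventually_nhds_in_open) auto
    then show ?thesis
      by (intro supersolution_test[OF super w f]) (auto elim!: eventually_mono intro!: z)
  next
    case True
    \<comment> \<open>At the seam the test function follows the end of the period to the left of 0
      and its beginning to the right; \<open>w01\<close> and \<open>f01\<close> make it C1.\<close>
    define \<psi> where "\<psi> x = (if x \<in> {..0} then w (x + 1) else w x)" for x
    define h where "h x = (if x \<in> {..0} then f (x + 1) else f x)" for x
    have "(\<psi> has_vector_derivative h x) (at x within UNIV)" for x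
      unfolding \<psi>_def h_def
    proof (rule has_vector_derivative_If_within_closures[where T = "{0<..}"])
      have "((\<lambda>x. w (x + 1)) has_real_derivative f (x + 1)) (at x)"
        using w[of "x+1"] by (simp add: DERIV_shift)
      then show "((\<lambda>x. w (x + 1)) has_vector_derivative f (x + 1))
          (at x within {..0} \<union> closure {..0} \<inter> closure {0<..})"
        using has_field_derivative_at_within has_real_derivative_iff_has_vector_derivative by blast
      show "(w has_vector_derivative f x) (at x within {0<..} \<union> closure {..0} \<inter> closure {0<..})"
        using w has_field_derivative_at_within has_real_derivative_iff_has_vector_derivative by blast
    qed (use w01 f01 in auto)
    then have \<psi>: "(\<psi> has_real_derivative h x) (at x)" for x
      by (simp add: has_real_derivative_iff_has_vector_derivative)
    have "continuous_on ({..0} \<union> {0..}) (\<lambda>x. if x \<in> {..0} then f (x + 1) else f x)"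
      using f01 by (intro continuous_on_If)
        (auto intro!: continuous_on_compose2[OF f] continuous_intros elim: continuous_on_subset[OF f])
    moreover have "{..0} \<union> {0..} = (UNIV :: real set)" by auto
    ultimately have h: "continuous_on UNIV h" by (simp add: h_def[abs_def])
    have "eventually (\<lambda>y. y \<in> {-1<..<1}) (nhds z)"
      using True by (intro eventually_nhds_in_open) auto
    then have "eventually (\<lambda>y. u y - \<psi> y \<ge> u z - \<psi> z) (nhds z)"
    proof (rule eventually_mono)
      fix y :: real assume y: "y \<in> {-1<..<1}"
      have "\<psi> z = w z" using True w01 by (simp add: \<psi>_def)
      then show "u y - \<psi> y \<ge> u z - \<psi> z"
        using z(3)[of y] z(3)[of "y+1"] per[of y] y by (auto simp: \<psi>_def)
    qed
    then have "F z (u z) (h z) \<ge> 0"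
      by (rule supersolution_test[OF super \<psi> h])
    then show ?thesis using True f01 by (simp add: h_def)
  qed
  ultimately show False by simp
qed

text \<open>The hypothesis \<open>le\<close> holds for every slope, so one point touched from above
  inside an interval where \<open>u\<close> exceeds \<open>g\<close> gives a contradiction. A steep
  parabola provides such a point, whatever its slope there.\<close>

lemma subsolution_le:
  assumes sub: "viscosity_subsolution F u"
    and cont: "continuous_on UNIV u" "continuous_on UNIV g"
    and le: "\<And>x p. F x (u x) p \<le> 0 \<Longrightarrow> u x \<le> g x"
  shows "u x \<le> g x"
proof (rule ccontr)
  assume "\<not> u x \<le> g x"
  moreover have "open {y. g y < u y}"
    using cont by (intro open_Collect_less)
  ultimately obtain d where d: "d > 0" "\<And>y. \<bar>y - x\<bar> \<le> d \<Longrightarrow> g y < u y"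
    using open_contains_cball[of "{y. g y < u y}"]
    by (auto simp: subset_iff dist_real_def abs_minus_commute not_le)
  have "compact (u ` {x-d..x+d})"
    using cont by (intro compact_continuous_image) (auto elim: continuous_on_subset)
  then obtain B where B: "\<And>y. y \<in> {x-d..x+d} \<Longrightarrow> \<bar>u y\<bar> \<le> B"
    using compact_imp_bounded bounded_real by (metis imageI)
  \<comment> \<open>The penalty is \<open>2 * B + 1\<close> at distance \<open>d\<close>, more than
    the oscillation of \<open>u\<close> on the interval, which keeps the maximum away from both
    endpoints.\<close>
  define N where "N = (2 * B + 1) / d\<^sup>2"
  have cq: "continuous_on {x-d..x+d} (\<lambda>y. u y - N * (y - x)\<^sup>2)"
    using cont by (auto intro!: continuous_intros elim: continuous_on_subset)
  then obtain z where z: "z \<in> {x-d..x+d}"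
      "\<And>y. y \<in> {x-d..x+d} \<Longrightarrow> u y - N * (y - x)\<^sup>2 \<le> u z - N * (z - x)\<^sup>2"
    using continuous_attains_sup[of "{x-d..x+d}"] d(1) by force
  have "z \<noteq> x + s * d" if "s = 1 \<or> s = -1" for s
  proof
    assume "z = x + s * d"
    then have "(z - x)\<^sup>2 = d\<^sup>2" using that by (auto simp: power2_eq_square)
    then have "N * (z - x)\<^sup>2 = 2 * B + 1" using d(1) by (simp add: N_def)
    then show False
      using z(2)[of x] B[of z] B[of x] z(1) d(1) by auto
  qed
  from this[of 1] this[of "-1"] have "z \<in> {x-d<..<x+d}" using z(1) by auto
  then have "eventually (\<lambda>y. y \<in> {x-d<..<x+d}) (nhds z)"
    by (intro eventually_nhds_in_open) auto
  then have "eventually (\<lambda>y. u y - N * (y - x)\<^sup>2 \<le> u z - N * (z - x)\<^sup>2) (nhds z)"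
    by (rule eventually_mono) (auto intro!: z)
  then have "F z (u z) (2 * N * (z - x)) \<le> 0"
    by (intro subsolution_test[OF sub, where w = "\<lambda>y. N * (y - x)\<^sup>2"])
      (auto intro!: derivative_eq_intros continuous_intros)
  from le[OF this] show False using d(2)[of z] z(1) by (auto simp: abs_le_iff)
qed

text \<open>
  A steep barrier placed to the right of a point of violation keeps the maximum away from
  the right end; this costs nothing since only slopes above \<open>f\<close> are excluded.
\<close>

lemma subsolution_increment_le_right:
  assumes sub: "viscosity_subsolution F u" and cont: "continuous_on UNIV u"
    and W: "\<And>x. (W has_real_derivative f x) (at x)" and f: "continuous_on UNIV f"
    and steep: "\<And>x p. l < x \<Longrightarrow> x < h \<Longrightarrow> f x \<le> p \<Longrightarrow> F x (u x) p > 0"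
    and x: "l \<le> x" "x < h"
  shows "u x - u l \<le> W x - W l"
proof (rule ccontr)
  assume neg: "\<not> u x - u l \<le> W x - W l"
  define b where "b = (x + h) / 2"
  have b: "x < b" "b < h" using x by (auto simp: b_def)
  \<comment> \<open>With this factor the value at \<open>b\<close> drops below the value at
    \<open>x\<close> by at least 1, while \<open>neg\<close> rules out \<open>l\<close>; the maximum
    is interior.\<close>
  define N where "N = (\<bar>u b - W b - (u x - W x)\<bar> + 1) / (b - x)\<^sup>2"
  define \<phi> where "\<phi> y = W y + N * (max 0 (y - x))\<^sup>2" for y
  define g where "g y = f y + N * (2 * max 0 (y - x))" for y
  have N: "N \<ge> 0" by (simp add: N_def)
  have \<phi>: "(\<phi> has_real_derivative g y) (at y)" for y
    unfolding \<phi>_def g_def by (intro DERIV_add W DERIV_cmult has_real_derivative_max_square)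
  have g: "continuous_on UNIV g"
    unfolding g_def by (intro continuous_intros f)
  have "continuous_on A \<phi>" for A
    using \<phi> DERIV_isCont continuous_at_imp_continuous_on by blast
  then have "continuous_on {l..b} (\<lambda>y. u y - \<phi> y)"
    using cont by (auto intro!: continuous_intros elim: continuous_on_subset)
  then obtain z where z: "z \<in> {l..b}" "\<And>y. y \<in> {l..b} \<Longrightarrow> u y - \<phi> y \<le> u z - \<phi> z"
    using continuous_attains_sup[of "{l..b}"] x b by force
  have "u x - \<phi> x \<le> u z - \<phi> z" using z(2)[of x] x b by auto
  moreover have "\<phi> x = W x" by (simp add: \<phi>_def)
  moreover have "\<phi> l = W l" using x by (simp add: \<phi>_def)
  moreover have "\<phi> b = W b + (\<bar>u b - W b - (u x - W x)\<bar> + 1)"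
    using b by (simp add: \<phi>_def N_def)
  ultimately have "z \<noteq> l" "z \<noteq> b" using neg by auto
  then have zi: "z \<in> {l<..<b}" using z(1) by auto
  then have "eventually (\<lambda>y. y \<in> {l<..<b}) (nhds z)"
    by (intro eventually_nhds_in_open) auto
  then have "eventually (\<lambda>y. u y - \<phi> y \<le> u z - \<phi> z) (nhds z)"
    by (rule eventually_mono) (auto intro!: z)
  then have "F z (u z) (g z) \<le> 0"
    by (rule subsolution_test[OF sub \<phi> g])
  moreover have "F z (u z) (g z) > 0"
    using zi b N by (intro steep) (auto simp: g_def)
  ultimately show False by simp
qed

text \<open>A test function at \<open>x\<close> for the reflected function, composed with the
  reflection, tests \<open>u\<close> at \<open>-x\<close> with the opposite slope. This reduces
  leftward increments to rightward ones.\<close>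

lemma viscosity_subsolution_reflect:
  assumes "viscosity_subsolution F u"
  shows "viscosity_subsolution (\<lambda>x z p. F (-x) z (-p)) (\<lambda>x. u (-x))"
  unfolding viscosity_subsolution_def
proof (intro allI impI)
  fix \<phi> :: "real \<Rightarrow> real" and x :: real
  assume C1: "\<phi> C1_differentiable_on UNIV"
    and ev: "\<forall>\<^sub>F y in nhds x. u (-y) - \<phi> y \<le> u (-x) - \<phi> x"
  obtain f where f: "\<And>y. (\<phi> has_real_derivative f y) (at y)" "continuous_on UNIV f"
    using C1 by (auto simp: C1_differentiable_on_def has_real_derivative_iff_has_vector_derivative)
  have d: "((\<lambda>y. \<phi> (-y)) has_real_derivative - f (-y)) (at y)" for y
    by (rule DERIV_cong[OF DERIV_chain2[OF f(1), of _ "-1"]]) (auto intro!: derivative_eq_intros)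
  have c: "continuous_on UNIV (\<lambda>y. - f (-y))"
    by (intro continuous_intros continuous_on_compose2[OF f(2)]) auto
  have "\<forall>\<^sub>F y in nhds (-x). u (-(-y)) - \<phi> (-y) \<le> u (-x) - \<phi> x"
  proof -
    obtain e where e: "e > 0" "\<And>y. dist y x < e \<Longrightarrow> u (-y) - \<phi> y \<le> u (-x) - \<phi> x"
      using ev by (auto simp: eventually_nhds_metric)
    have "dist (-y) x < e" if "dist y (-x) < e" for y
      using that by (simp add: dist_real_def abs_minus_commute abs_if split: if_splits)
    then show ?thesis
      using e(1) e(2)[of "- y" for y] by (auto simp: eventually_nhds_metric intro!: exI[of _ e])
  qed
  then have "F (-x) (u (-x)) (- f (-(-x))) \<le> 0"
    by (intro subsolution_test[OF assms d c]) simp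
  then show "F (-x) (u (-x)) (- deriv \<phi> x) \<le> 0"
    using DERIV_imp_deriv[OF f(1)] by simp
qed

lemma subsolution_increment_le_left:
  assumes sub: "viscosity_subsolution F u" and cont: "continuous_on UNIV u"
    and W: "\<And>x. (W has_real_derivative f x) (at x)" and f: "continuous_on UNIV f"
    and steep: "\<And>x p. l < x \<Longrightarrow> x < h \<Longrightarrow> p \<le> f x \<Longrightarrow> F x (u x) p > 0"
    and x: "l < x" "x \<le> h"
  shows "u x - u h \<le> W x - W h"
proof -
  have "u (-(-x)) - u (-(-h)) \<le> W (-(-x)) - W (-(-h))"
  proof (rule subsolution_increment_le_right[OF viscosity_subsolution_reflect[OF sub],
        where W = "\<lambda>x. W (-x)" and f = "\<lambda>x. - f (-x)" and h = "-l"])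
    show "continuous_on UNIV (\<lambda>x. u (-x))" "continuous_on UNIV (\<lambda>x. - f (-x))"
      by (auto intro!: continuous_intros continuous_on_compose2[OF f] continuous_on_compose2[OF cont])
    show "((\<lambda>x. W (-x)) has_real_derivative - f (-y)) (at y)" for y
      by (rule DERIV_cong[OF DERIV_chain2[OF W, of _ "-1"]]) (auto intro!: derivative_eq_intros)
  qed (use steep x in auto)
  then show ?thesis by simp
qed

section \<open>The lower rate\<close>

text \<open>The zero energy curve is \<open>p = - a \<plusminus> \<rho> x\<close>, and
  \<open>R 1\<close> is the threshold a_*. Comparisons take place on one period, whose endpoints are
  the zeros of \<open>V\<close>.\<close>

locale discounted_potential =
  fixes V \<rho> R :: "real \<Rightarrow> real" and a :: real
  assumes V_eq: "V x = - (\<rho> x)\<^sup>2 / 2"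
    and continuous_rho: "continuous_on UNIV \<rho>"
    and rho_nonneg: "0 \<le> \<rho> x"
    and rho_pos: "0 < x \<Longrightarrow> x < 1 \<Longrightarrow> 0 < \<rho> x"
    and rho_0: "\<rho> 0 = 0" and rho_1: "\<rho> 1 = 0"
    and R: "(R has_real_derivative \<rho> x) (at x)" and R_0: "R 0 = 0"
    and a_pos: "0 < a" and a_less: "a < R 1"
begin

section \<open>Pointwise bounds for solutions and their limit\<close>

definition F :: "real \<Rightarrow> real \<Rightarrow> real \<Rightarrow> real \<Rightarrow> real" where
  "F s x z p = s * z + hamiltonian V a x p"

lemma F_eq: "F s x z p = s * z + ((p + a)\<^sup>2 - (\<rho> x)\<^sup>2) / 2"
  by (simp add: F_def hamiltonian_def V_eq field_simps)

lemma continuous_R: "continuous_on A R"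
  using R DERIV_isCont continuous_at_imp_continuous_on by blast

lemma R_mono: "x \<le> y \<Longrightarrow> R x \<le> R y"
  using increment_le[of "\<lambda>_. 0" "\<lambda>_. 0" R \<rho> x y] R rho_nonneg by simp

text \<open>The kinetic term is nonnegative, so the subsolution inequality bounds
  \<open>s * u\<close> by \<open>- V\<close> for every slope.\<close>

lemma solution_le:
  assumes "viscosity_solution (F s) u" "s > 0"
  shows "u x \<le> - V x / s"
proof -
  have "u x \<le> (\<rho> x)\<^sup>2 / (2 * s)"
  proof (rule subsolution_le[of "F s" u "\<lambda>x. (\<rho> x)\<^sup>2 / (2 * s)" x])
    show "viscosity_subsolution (F s) u" "continuous_on UNIV u"
      using assms by (auto simp: viscosity_solution_def)
    show "continuous_on UNIV (\<lambda>x. (\<rho> x)\<^sup>2 / (2 * s))"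
      using assms by (intro continuous_intros continuous_rho) auto
  next
    fix x p assume "F s x (u x) p \<le> 0"
    then have "2 * (s * u x) + (p + a)\<^sup>2 \<le> (\<rho> x)\<^sup>2"
      by (simp add: F_eq diff_divide_distrib)
    then have "2 * (s * u x) \<le> (\<rho> x)\<^sup>2"
      by (rule order.trans[rotated]) simp
    then show "u x \<le> (\<rho> x)\<^sup>2 / (2 * s)"
      using assms by (simp add: field_simps)
  qed
  then show ?thesis by (simp add: V_eq field_simps)
qed

text \<open>For \<open>s > 0\<close> the equation is strictly increasing in the value, so a
  non-strict classical subsolution yields the strict inequality at every value below
  \<open>w x\<close>.\<close>

lemma solution_ge:
  assumes "viscosity_solution (F s) u"
    and "\<And>x. (w has_real_derivative f x) (at x)" and "continuous_on UNIV f"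
    and "w 0 = w 1" and "f 0 = f 1" and s: "s > 0"
    and sub: "\<And>x. 0 \<le> x \<Longrightarrow> x < 1 \<Longrightarrow> F s x (w x) (f x) \<le> 0"
    and "x \<in> {0..1}"
  shows "w x \<le> u x"
proof (rule supersolution_ge[of "F s" u w f x])
  show "viscosity_supersolution (F s) u" "continuous_on UNIV u"
    using assms(1) by (auto simp: viscosity_solution_def)
  show "u (x + 1) = u x" for x
    using assms(1) by (auto simp: viscosity_solution_def periodic_fun_simple'_def)
  fix x z :: real assume "0 \<le> x" "x < 1" "z < w x"
  moreover have "s * z < s * w x" using \<open>z < w x\<close> s by simp
  ultimately show "F s x z (f x) < 0" using sub[of x] by (simp add: F_eq)
qed (use assms in auto)

text \<open>The slope \<open>\<kappa> * \<rho> - a\<close> leaves the energy deficit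
  \<open>(1 - \<kappa>\<^sup>2) * \<rho>\<^sup>2 / 2\<close>, which must absorb
  \<open>s * (v - c)\<close>. Where \<open>v < c\<close> nothing has to be absorbed; where
  \<open>v \<ge> c\<close> the point stays away from the zeros of \<open>\<rho>\<close>, because
  \<open>v\<close> vanishes at 0 and 1, and the deficit is bounded below.\<close>

lemma eventually_solution_ge:
  assumes u: "\<And>s. s > 0 \<Longrightarrow> viscosity_solution (F s) (u s)"
    and c: "c > 0" and x: "x \<in> {0..1}"
  shows "\<forall>\<^sub>F s in at_right 0. a / R 1 * R x - a * x - c \<le> u s x"
proof -
  \<comment> \<open>The value of \<kappa> is forced by \<open>v 1 = 0\<close>; it is below 1 because
    \<open>a < R 1\<close>.\<close>
  define \<kappa> where "\<kappa> = a / R 1"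
  have \<kappa>: "0 < \<kappa>" "\<kappa> < 1" "\<kappa> * R 1 = a" using a_pos a_less by (auto simp: \<kappa>_def)
  define v where "v x = \<kappa> * R x - a * x" for x
  have contv: "continuous_on A v" for A
    unfolding v_def by (intro continuous_intros continuous_R)
  define A where "A = {0..1} \<inter> {x. c \<le> v x}"
  have "closed {x. c \<le> v x}"
    using contv by (intro closed_Collect_le) auto
  then have "compact A" unfolding A_def by (intro compact_Int_closed) auto
  obtain m where m: "m > 0" "\<And>x. x \<in> A \<Longrightarrow> m \<le> \<rho> x"
  proof (cases "A = {}")
    case False
    then obtain y where y: "y \<in> A" "\<And>x. x \<in> A \<Longrightarrow> \<rho> y \<le> \<rho> x"
      using continuous_attains_inf[OF \<open>compact A\<close> False continuous_on_subset[OF continuous_rho]] by auto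
    have "v 0 = 0" "v 1 = 0" using \<kappa> R_0 by (auto simp: v_def)
    then have "y \<noteq> 0" "y \<noteq> 1" using y(1) c by (auto simp: A_def)
    then have "0 < \<rho> y" using y(1) by (intro rho_pos) (auto simp: A_def)
    then show ?thesis using y that by blast
  qed (auto intro: that[of 1])
  \<comment> \<open>On \<open>A\<close> the discount term is at most \<open>s * a\<close>;
    \<open>d\<close> is the value of \<open>s\<close> at which this equals the lower bound for the
    deficit.\<close>
  define d where "d = (1 - \<kappa>\<^sup>2) * m\<^sup>2 / (2 * a)"
  have k2: "\<kappa>\<^sup>2 < 1" using \<kappa> by (simp add: abs_square_less_1)
  then have "d > 0" using m a_pos by (simp add: d_def)
  then have "\<forall>\<^sub>F s in at_right 0. s \<in> {0<..<d}"
    using eventually_at_right_real by blast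
  then show ?thesis
  proof (rule eventually_mono)
    fix s assume s: "s \<in> {0<..<d}"
    have "v x - c \<le> u s x"
    proof (rule solution_ge[OF u, of s _ "\<lambda>x. \<kappa> * \<rho> x - a"])
      show "((\<lambda>x. v x - c) has_real_derivative \<kappa> * \<rho> y - a) (at y)" for y
        unfolding v_def by (auto intro!: derivative_eq_intros R)
      show "continuous_on UNIV (\<lambda>x. \<kappa> * \<rho> x - a)"
        by (intro continuous_intros continuous_rho)
      fix y :: real assume y: "0 \<le> y" "y < 1"
      have "s * (v y - c) \<le> (1 - \<kappa>\<^sup>2) * (\<rho> y)\<^sup>2 / 2"
      proof (cases "y \<in> A")
        case True
        have "\<kappa> * R y \<le> \<kappa> * R 1" using y \<kappa>(1) R_mono[of y 1] by (intro mult_left_mono) auto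
        moreover have "0 \<le> a * y" using a_pos y by simp
        ultimately have "v y - c \<le> a" unfolding v_def \<kappa>(3) using c by linarith
        then have "s * (v y - c) \<le> d * a"
          using s a_pos \<open>d > 0\<close> by (intro order.trans[OF mult_left_mono mult_right_mono]) auto
        also have "\<dots> = (1 - \<kappa>\<^sup>2) * m\<^sup>2 / 2" using a_pos by (simp add: d_def)
        also have "\<dots> \<le> (1 - \<kappa>\<^sup>2) * (\<rho> y)\<^sup>2 / 2"
          using m True k2 by (intro divide_right_mono mult_left_mono power_mono) auto
        finally show ?thesis .
      next
        case False
        then have "v y - c \<le> 0" using y by (simp add: A_def)
        then have "s * (v y - c) \<le> 0" using s by (simp add: mult_nonneg_nonpos)
        also have "0 \<le> (1 - \<kappa>\<^sup>2) * (\<rho> y)\<^sup>2 / 2" using k2 by simp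
        finally show ?thesis .
      qed
      then show "F s y (v y - c) (\<kappa> * \<rho> y - a) \<le> 0"
        by (simp add: F_eq field_simps)
    qed (use s x \<kappa> rho_0 rho_1 R_0 in \<open>auto simp: v_def\<close>)
    then show "a / R 1 * R x - a * x - c \<le> u s x"
      by (simp add: v_def \<kappa>_def)
  qed
qed

lemma limit_ge:
  assumes u: "\<And>s. s > 0 \<Longrightarrow> viscosity_solution (F s) (u s)"
    and lim: "((\<lambda>s. u s x) \<longlongrightarrow> u0 x) (at_right 0)" and x: "x \<in> {0..1}"
  shows "a / R 1 * R x - a * x \<le> u0 x"
proof (rule field_le_epsilon)
  fix c :: real assume "c > 0"
  have "a / R 1 * R x - a * x - c \<le> u0 x"
    by (rule tendsto_lowerbound[OF lim eventually_solution_ge[OF u \<open>c > 0\<close> x]]) auto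
  then show "a / R 1 * R x - a * x \<le> u0 x + c" by simp
qed

text \<open>
  The gap is read off at the equilibrium \<open>x = -t\<close> of the discounted characteristic flow, up to a
  constant factor in \<open>t\<close>: there \<open>u\<^sub>0 \<approx> a t\<close>, while \<open>u\<^sub>\<lambda> \<le> - V / \<lambda> = t\<^sup>2\<^sup>r / \<lambda>\<close>.
\<close>

lemma limit_gap:
  assumes u: "\<And>s. s > 0 \<Longrightarrow> viscosity_solution (F s) (u s)"
    and lim: "\<And>x. ((\<lambda>s. u s x) \<longlongrightarrow> u0 x) (at_right 0)"
    and "r \<ge> 1" and "\<delta> > 0" and V: "\<And>t. 0 \<le> t \<Longrightarrow> t < \<delta> \<Longrightarrow> V (1 - t) = - (t ^ (2 * r))"
  shows "\<exists>C>0. \<forall>\<^sub>F s in at_right 0. \<exists>x. C * s powr (1 / (2 * real r - 1)) \<le> u0 x - u s x"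
proof -
  define \<alpha> where "\<alpha> = 1 / (2 * real r - 1)"
  have \<alpha>: "\<alpha> > 0" "\<alpha> * real (2 * r - 1) = 1"
    using \<open>r \<ge> 1\<close> by (auto simp: \<alpha>_def of_nat_diff)
  have "isCont \<rho> 1" using continuous_rho by (simp add: continuous_on_eq_continuous_at)
  \<comment> \<open>This bound makes the error \<open>R 1 - R (1 - T)\<close> at most
    \<open>a * T / 4\<close>.\<close>
  then have "\<forall>\<^sub>F x in nhds 1. \<rho> x < a / 4"
    using a_pos rho_1 by (intro order_tendstoD(2)[of _ 0]) (auto simp: isCont_def tendsto_nhds_iff)
  then obtain \<eta> where \<eta>: "\<eta> > 0" "\<And>x. dist x 1 < \<eta> \<Longrightarrow> \<rho> x < a / 4"
    by (auto simp: eventually_nhds_metric)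
  \<comment> \<open>The choice solves \<open>T ^ (2 * r - 1) = s * a / 4\<close>, hence
    \<open>- V (1 - T) / s = a * T / 4\<close>. As the limit is at least
    \<open>3 * a * T / 4\<close> at \<open>1 - T\<close>, a gap of \<open>a * T / 2\<close>
    remains.\<close>
  define t where "t s = (s * a / 4) powr \<alpha>" for s
  have "((\<lambda>s. t s) \<longlongrightarrow> 0) (at_right 0)"
    unfolding t_def using \<alpha> a_pos
    by (intro tendsto_zero_powrI[where b = \<alpha>] tendsto_eq_intros)
      (auto intro!: eventually_at_rightI[of 0 1] tendsto_eq_intros)
  then have "\<forall>\<^sub>F s in at_right 0. t s < min \<delta> (min \<eta> 1)"
    using \<eta> \<open>\<delta> > 0\<close> by (intro order_tendstoD(2)) auto
  moreover have "\<forall>\<^sub>F s::real in at_right 0. s > 0"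
    by (rule eventually_at_right_less)
  ultimately have "\<forall>\<^sub>F s in at_right 0. \<exists>x. a / 2 * (a / 4) powr \<alpha> * s powr \<alpha> \<le> u0 x - u s x"
  proof eventually_elim
    case (elim s)
    define T where "T = t s"
    have T: "0 < T" "T < \<delta>" "T < \<eta>" "T < 1" using elim a_pos by (auto simp: T_def t_def)
    have "T ^ (2 * r - 1) = T powr real (2 * r - 1)" using T by (simp only: powr_realpow)
    also have "\<dots> = (s * a / 4) powr (\<alpha> * real (2 * r - 1))"
      by (simp only: T_def t_def powr_powr)
    also have "\<dots> = s * a / 4"
      unfolding \<alpha>(2) using elim a_pos by simp
    finally have *: "T ^ (2 * r - 1) = s * a / 4" .
    have "T ^ (2 * r) = T * T ^ (2 * r - 1)"
      using \<open>r \<ge> 1\<close> by (subst power_Suc[symmetric]) (simp add: Suc_diff_le)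
    then have "V (1 - T) = - (T * (s * a / 4))" using V[of T] T by (simp only: *)
    then have 1: "u s (1 - T) \<le> a * T / 4"
      using solution_le[OF u, of s "1 - T"] elim by (simp add: mult.commute)
    have "R 1 - R (1 - T) \<le> a / 4 * 1 - a / 4 * (1 - T)"
    proof (rule increment_le[OF R, of "\<lambda>x. a / 4 * x" "\<lambda>_. a / 4"])
      fix x assume "1 - T \<le> x" "x \<le> 1"
      then show "\<rho> x \<le> a / 4" using T by (intro less_imp_le \<eta>) (auto simp: dist_real_def)
    qed (use T in \<open>auto intro!: derivative_eq_intros\<close>)
    moreover have "a / 4 * 1 - a / 4 * (1 - T) = a * T / 4" by (simp add: right_diff_distrib)
    ultimately have "R 1 - a * T / 4 \<le> R (1 - T)" by linarith
    then have "a / R 1 * (R 1 - a * T / 4) \<le> a / R 1 * R (1 - T)"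
      using a_pos a_less by (intro mult_left_mono) auto
    moreover have "a / R 1 * (R 1 - a * T / 4) = a - a / R 1 * (a * T / 4)"
      using a_pos a_less by (simp add: algebra_simps)
    moreover have "a / R 1 * (a * T / 4) \<le> 1 * (a * T / 4)"
      using a_pos a_less T by (intro mult_right_mono) auto
    ultimately have "a - a * T / 4 \<le> a / R 1 * R (1 - T)" by linarith
    moreover have "a / R 1 * R (1 - T) - a * (1 - T) \<le> u0 (1 - T)"
      using T by (intro limit_ge[OF u lim]) auto
    ultimately have "a * T / 2 \<le> u0 (1 - T) - u s (1 - T)"
      using 1 by (simp add: algebra_simps)
    moreover have "T = (a / 4) powr \<alpha> * s powr \<alpha>"
      using elim a_pos by (simp add: T_def t_def flip: powr_mult) (simp add: mult.commute)
    ultimately show ?case by (intro exI[of _ "1 - T"]) (simp add: algebra_simps)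
  qed
  then show ?thesis unfolding \<alpha>_def
    using a_pos by (intro exI[of _ "a / 2 * (a / 4) powr \<alpha>"]) (auto simp: \<alpha>_def)
qed

end

section \<open>Barriers and the linear rate\<close>

text \<open>This is the average of the positive part over the interval from
  \<open>z - \<epsilon>\<close> to \<open>z + \<epsilon>\<close>, for
  \<open>\<epsilon> > 0\<close>.\<close>

definition smooth_pos_part :: "real \<Rightarrow> real \<Rightarrow> real" where
  "smooth_pos_part \<epsilon> z = ((max 0 (z + \<epsilon>))\<^sup>2 - (max 0 (z - \<epsilon>))\<^sup>2) / (4 * \<epsilon>)"

lemma smooth_pos_part_eq:
  assumes "\<epsilon> > 0"
  shows "\<epsilon> \<le> z \<Longrightarrow> smooth_pos_part \<epsilon> z = z" "z \<le> - \<epsilon> \<Longrightarrow> smooth_pos_part \<epsilon> z = 0"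
proof -
  assume "\<epsilon> \<le> z"
  then have "max 0 (z + \<epsilon>) = z + \<epsilon>" "max 0 (z - \<epsilon>) = z - \<epsilon>" using assms by auto
  moreover have "(z + \<epsilon>)\<^sup>2 - (z - \<epsilon>)\<^sup>2 = 4 * \<epsilon> * z"
    by (simp add: power2_eq_square algebra_simps)
  ultimately show "smooth_pos_part \<epsilon> z = z" using assms by (simp add: smooth_pos_part_def)
next
  assume "z \<le> - \<epsilon>"
  then have "max 0 (z + \<epsilon>) = 0" "max 0 (z - \<epsilon>) = 0" using assms by auto
  then show "smooth_pos_part \<epsilon> z = 0" by (simp add: smooth_pos_part_def)
qed

text \<open>Averaging a convex function cannot lower it, and averaging a 1-Lipschitz function over
  radius \<epsilon> changes it by at most \<epsilon>. In the transition zone this amounts to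
  \<open>(z - \<epsilon>)\<^sup>2 \<ge> 0\<close> and
  \<open>z + \<epsilon> \<le> 2 * \<epsilon>\<close>.\<close>

lemma smooth_pos_part_bounds:
  assumes "\<epsilon> > 0"
  shows "max 0 z \<le> smooth_pos_part \<epsilon> z" "smooth_pos_part \<epsilon> z \<le> max 0 z + \<epsilon>"
proof -
  consider "\<epsilon> \<le> z" | "z \<le> - \<epsilon>" | "- \<epsilon> < z" "z < \<epsilon>" by linarith
  then have "max 0 z \<le> smooth_pos_part \<epsilon> z \<and> smooth_pos_part \<epsilon> z \<le> max 0 z + \<epsilon>"
  proof cases
    case 3
    then have eq: "smooth_pos_part \<epsilon> z = (z + \<epsilon>)\<^sup>2 / (4 * \<epsilon>)"
      using max.absorb2[of 0 "z + \<epsilon>"] max.absorb1[of "z - \<epsilon>" 0]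
      by (simp add: smooth_pos_part_def)
    have "4 * \<epsilon> * z \<le> (z + \<epsilon>)\<^sup>2"
      using zero_le_power2[of "z - \<epsilon>"] by (simp add: power2_eq_square algebra_simps)
    then have "z \<le> smooth_pos_part \<epsilon> z"
      using assms by (simp add: eq field_simps)
    moreover have "0 \<le> smooth_pos_part \<epsilon> z" using assms by (simp add: eq)
    moreover have "(z + \<epsilon>)\<^sup>2 \<le> 4 * \<epsilon> * (max 0 z + \<epsilon>)"
    proof -
      have "(z + \<epsilon>)\<^sup>2 \<le> 2 * \<epsilon> * (z + \<epsilon>)"
        unfolding power2_eq_square using 3 by (intro mult_right_mono) auto
      also have "\<dots> \<le> 4 * \<epsilon> * (max 0 z + \<epsilon>)"
        using assms 3 by (intro mult_mono) auto
      finally show ?thesis .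
    qed
    then have "smooth_pos_part \<epsilon> z \<le> max 0 z + \<epsilon>"
      using assms by (simp add: eq field_simps)
    ultimately show ?thesis by simp
  next
    case 1
    then show ?thesis using assms by (simp add: smooth_pos_part_eq)
  next
    case 2
    then show ?thesis using assms by (simp add: smooth_pos_part_eq)
  qed
  then show "max 0 z \<le> smooth_pos_part \<epsilon> z" "smooth_pos_part \<epsilon> z \<le> max 0 z + \<epsilon>" by auto
qed

lemma has_real_derivative_smooth_pos_part:
  "(smooth_pos_part \<epsilon> has_real_derivative (max 0 (z + \<epsilon>) - max 0 (z - \<epsilon>)) / (2 * \<epsilon>)) (at z)"
proof -
  have "((\<lambda>z. ((max 0 (z - - \<epsilon>))\<^sup>2 - (max 0 (z - \<epsilon>))\<^sup>2) / (4 * \<epsilon>)) has_real_derivative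
      (2 * max 0 (z - - \<epsilon>) - 2 * max 0 (z - \<epsilon>)) / (4 * \<epsilon>)) (at z)"
    by (intro DERIV_cdivide DERIV_diff has_real_derivative_max_square)
  moreover have "(2 * max 0 (z - - \<epsilon>) - 2 * max 0 (z - \<epsilon>)) / (4 * \<epsilon>)
      = (max 0 (z + \<epsilon>) - max 0 (z - \<epsilon>)) / (2 * \<epsilon>)"
    using mult_divide_mult_cancel_left[of 2 "max 0 (z + \<epsilon>) - max 0 (z - \<epsilon>)" "2 * \<epsilon>"]
    by (simp only: right_diff_distrib diff_minus_eq_add) simp
  moreover have "smooth_pos_part \<epsilon> = (\<lambda>z. ((max 0 (z - - \<epsilon>))\<^sup>2 - (max 0 (z - \<epsilon>))\<^sup>2) / (4 * \<epsilon>))"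
    by (simp add: smooth_pos_part_def fun_eq_iff)
  ultimately show ?thesis by simp
qed

section \<open>Two-sided comparison with the explicit limit\<close>

context discounted_potential
begin

text \<open>The two branches are the cost of reaching \<open>x\<close> rightward from 0 and leftward
  from 1. Since \<open>0 < a < R 1\<close>, the minimum vanishes at both ends.\<close>

definition barrier :: "real \<Rightarrow> real" where
  "barrier x = min (R x - a * x) (R 1 - R x + a * (1 - x))"

text \<open>The barrier vanishes at both ends and grows from them at rate at most
  \<open>M + a\<close>, where \<open>M\<close> bounds \<open>\<rho>\<close>; linear growth of
  \<open>\<rho>\<close> from its zeros then dominates it. The lower bound near 1 uses
  \<open>a < R 1\<close>.\<close>

lemma barrier_le_rho:
  assumes "c > 0" and c: "\<And>x. x \<in> {0..1} \<Longrightarrow> c * min x (1 - x) \<le> \<rho> x"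
  shows "\<exists>K\<ge>0. \<forall>x\<in>{0..1}. \<bar>barrier x\<bar> \<le> K * \<rho> x"
proof -
  have "compact (\<rho> ` {0..1})"
    using continuous_rho by (intro compact_continuous_image) (auto elim: continuous_on_subset)
  then obtain M where M: "\<And>x. x \<in> {0..1} \<Longrightarrow> \<rho> x \<le> M"
    using compact_imp_bounded bounded_real by (metis abs_le_iff imageI)
  have "M \<ge> 0" using M[of 0] rho_0 by simp
  define L where "L = M + a"
  have L: "L \<ge> 0" using \<open>M \<ge> 0\<close> a_pos by (simp add: L_def)
  have inc: "R y - R x \<le> M * y - M * x" if "0 \<le> x" "x \<le> y" "y \<le> 1" for x y
    using that M by (intro increment_le[OF R, of _ "\<lambda>_. M"]) (auto intro!: derivative_eq_intros)
  have "\<bar>barrier x\<bar> \<le> L / c * \<rho> x" if x: "x \<in> {0..1}" for x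
  proof -
    have "\<bar>barrier x\<bar> \<le> L * min x (1 - x)"
    proof -
      have R: "R x \<ge> 0" "R 1 - R x \<ge> 0" "R x \<le> M * x" "R 1 - R x \<le> M * (1 - x)"
        using R_mono[of 0 x] R_mono[of x 1] inc[of 0 x] inc[of x 1] x R_0 by (auto simp: algebra_simps)
      have "0 \<le> M * x" "0 \<le> a * x" "0 \<le> M * (1 - x)" "0 \<le> a * (1 - x)"
        using x \<open>M \<ge> 0\<close> a_pos by auto
      then have "\<bar>barrier x\<bar> \<le> L * x \<and> \<bar>barrier x\<bar> \<le> L * (1 - x)"
        using R a_less by (auto simp: barrier_def L_def min_def abs_le_iff algebra_simps)
      then show ?thesis by (simp add: min_def)
    qed
    also have "\<dots> = L / c * (c * min x (1 - x))" using \<open>c > 0\<close> by simp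
    also have "\<dots> \<le> L / c * \<rho> x" using c[OF x] L \<open>c > 0\<close> by (intro mult_left_mono) auto
    finally show ?thesis .
  qed
  then show ?thesis using L \<open>c > 0\<close> by (intro exI[of _ "L / c"]) auto
qed

text \<open>
  The comparison function has slope \<open>-a \<plusminus> max 0 (\<rho> - s K)\<close>. Its concave kink has to be smoothed
  because the supersolution inequality gives no information at concave kinks.
\<close>

lemma solution_ge_barrier:
  assumes u: "viscosity_solution (F s) u"
    and K: "K \<ge> 0" "\<And>x. x \<in> {0..1} \<Longrightarrow> \<bar>barrier x\<bar> \<le> K * \<rho> x"
    and s: "s > 0" "s * (K + 1) < R 1 - a" and x: "x \<in> {0..1}"
  shows "barrier x - s * (K\<^sup>2 + K + 1) \<le> u x"
proof -
  \<comment> \<open>Lowering \<open>\<rho>\<close> by \<open>s * K\<close> frees energy of order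
    \<open>s * K * \<rho>\<close>, enough to pay for the discount term. Truncation at 0 keeps
    \<open>q\<close> between 0 and \<open>\<rho>\<close> and makes the slopes at 0 and 1
    agree.\<close>
  define q where "q x = max 0 (\<rho> x - s * K)" for x
  have q: "0 \<le> q y" "q y \<le> \<rho> y" "\<rho> y - s * K \<le> q y" for y
    using rho_nonneg[of y] K s by (auto simp: q_def)
  have contq: "continuous_on UNIV q"
    unfolding q_def by (intro continuous_intros continuous_rho)
  obtain Q where Q_0: "Q 0 = 0" and Q: "\<And>x. (Q has_real_derivative q x) (at x)"
    using antiderivative_exists[OF contq] by blast
  have Q_le: "Q z - Q y \<le> R z - R y" if "y \<le> z" for y z
    using that q by (intro increment_le[OF Q R]) auto
  have Q_ge: "R z - R y - s * K * (z - y) \<le> Q z - Q y" if "y \<le> z" for y z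
  proof -
    have "R z - s * K * z - (R y - s * K * y) \<le> Q z - Q y"
      using that q(3) by (intro increment_le[OF _ Q, of _ "\<lambda>x. \<rho> x - s * K"])
        (auto intro!: derivative_eq_intros R)
    then show ?thesis by (simp add: algebra_simps)
  qed
  have "s * K \<ge> 0" using s K by simp
  have Q1: "0 \<le> Q 1" "s \<le> Q 1 - a"
    using Q_ge[of 0 1] Q_0 R_0 s increment_le[of "\<lambda>_. 0" "\<lambda>_. 0" Q q 0 1] Q q(1)
    by (auto simp: algebra_simps)
  \<comment> \<open>The difference of the two branches built from \<open>Q\<close> is
    \<open>z\<close>, so \<open>w\<close> is the second branch minus the smoothed positive part of
    \<open>z\<close>, a smoothed minimum. As \<theta> lies between 0 and 1, the slope of
    \<open>w\<close> plus \<open>a\<close> lies between \<open>- q\<close> and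
    \<open>q\<close>.\<close>
  define z where "z x = Q 1 + a - 2 * Q x" for x
  define \<theta> where "\<theta> x = (max 0 (z x + s) - max 0 (z x - s)) / (2 * s)" for x
  define w where "w x = Q 1 - Q x + a * (1 - x) - smooth_pos_part s (z x)" for x
  define f where "f x = (2 * \<theta> x - 1) * q x - a" for x
  have "0 \<le> \<theta> x" "\<theta> x \<le> 1" for x
    using s by (auto simp: \<theta>_def max_def)
  then have "\<bar>2 * \<theta> x - 1\<bar> \<le> 1" for x
    by (simp add: abs_le_iff)
  then have \<theta>: "(2 * \<theta> x - 1)\<^sup>2 \<le> 1" for x
    by (simp add: abs_square_le_1)
  have contQ: "continuous_on UNIV Q"
    using Q DERIV_isCont continuous_at_imp_continuous_on by blast
  have w: "((\<lambda>x. w x - s * K\<^sup>2) has_real_derivative f y) (at y)" for y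
  proof -
    have "(z has_real_derivative - 2 * q y) (at y)"
      unfolding z_def by (auto intro!: derivative_eq_intros Q)
    from DERIV_chain2[OF has_real_derivative_smooth_pos_part this, of s]
    have "((\<lambda>x. smooth_pos_part s (z x)) has_real_derivative \<theta> y * (- 2 * q y)) (at y)"
      by (simp add: \<theta>_def)
    then show ?thesis
      unfolding w_def f_def by (auto intro!: derivative_eq_intros Q simp: algebra_simps)
  qed
  have contf: "continuous_on UNIV f"
    unfolding f_def \<theta>_def z_def using s by (intro continuous_intros contq contQ) auto
  have q01: "q 0 = 0" "q 1 = 0" using \<open>s * K \<ge> 0\<close> by (simp_all add: q_def rho_0 rho_1)
  \<comment> \<open>Here \<open>z 0 \<ge> s\<close> and \<open>z 1 \<le> - s\<close>, so the
    smoothing is inactive at both ends.\<close>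
  have w01: "w 0 = 0" "w 1 = 0"
    using Q1 a_pos s Q_0 by (auto simp: w_def z_def smooth_pos_part_eq)
  have w_min: "w y = min (Q y - a * y) (Q 1 - Q y + a * (1 - y)) + max 0 (z y) - smooth_pos_part s (z y)" for y
    by (auto simp: w_def z_def min_def max_def algebra_simps)
  have "w x - s * K\<^sup>2 \<le> u x"
  proof (rule solution_ge[OF u w contf _ _ s(1) _ x])
    fix y :: real assume y: "0 \<le> y" "y < 1"
    have "w y \<le> min (Q y - a * y) (Q 1 - Q y + a * (1 - y))"
      using smooth_pos_part_bounds(1)[OF s(1), of "z y"] unfolding w_min by linarith
    also have "\<dots> \<le> barrier y"
      unfolding barrier_def using Q_le[of 0 y] Q_le[of y 1] y Q_0 R_0 by (intro min.mono) auto
    also have "\<dots> \<le> K * \<rho> y" using K(2)[of y] y by auto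
    finally have wK: "w y \<le> K * \<rho> y" .
    \<comment> \<open>Subtracting \<open>s * K\<^sup>2\<close> compensates the quadratic loss in the
      freed energy, and it makes the left side nonpositive where the truncation is active.\<close>
    have key: "s * (w y - s * K\<^sup>2) \<le> ((\<rho> y)\<^sup>2 - (q y)\<^sup>2) / 2"
    proof (cases "s * K \<le> \<rho> y")
      case True
      then have "((\<rho> y)\<^sup>2 - (q y)\<^sup>2) / 2 = s * (K * \<rho> y - s * K\<^sup>2) + (s * K)\<^sup>2 / 2"
        by (simp add: q_def power2_eq_square algebra_simps add_divide_distrib diff_divide_distrib)
      moreover have "s * (w y - s * K\<^sup>2) \<le> s * (K * \<rho> y - s * K\<^sup>2)"
        using wK s by (intro mult_left_mono) auto
      ultimately show ?thesis using zero_le_power2[of "s * K"] by linarith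
    next
      case False
      then have "K * \<rho> y \<le> K * (s * K)" using K by (intro mult_left_mono) auto
      then have "s * (w y - s * K\<^sup>2) \<le> 0"
        using wK s by (intro mult_nonneg_nonpos) (auto simp: power2_eq_square algebra_simps)
      also have "0 \<le> ((\<rho> y)\<^sup>2 - (q y)\<^sup>2) / 2" using False by (simp add: q_def)
      finally show ?thesis .
    qed
    have "(f y + a)\<^sup>2 = (2 * \<theta> y - 1)\<^sup>2 * (q y)\<^sup>2"
      by (simp add: f_def power_mult_distrib)
    also have "\<dots> \<le> (q y)\<^sup>2"
      using mult_right_mono[OF \<theta>[of y], of "(q y)\<^sup>2"] by simp
    finally show "F s y (w y - s * K\<^sup>2) (f y) \<le> 0"
      using key unfolding F_eq by (simp add: diff_divide_distrib)
  qed (use w01 q01 in \<open>auto simp: f_def\<close>)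
  \<comment> \<open>Replacing \<open>R\<close> by \<open>Q\<close> costs at most
    \<open>s * K\<close>, and the smoothing at most \<open>s\<close>.\<close>
  moreover have "barrier x - s * K - s \<le> w x"
  proof -
    have "s * K * x \<le> s * K * 1" "s * K * (1 - x) \<le> s * K * 1"
      using \<open>s * K \<ge> 0\<close> x by (intro mult_left_mono; simp)+
    then have "barrier x - s * K \<le> min (Q x - a * x) (Q 1 - Q x + a * (1 - x))"
      using Q_ge[of 0 x] Q_ge[of x 1] x Q_0 R_0 by (auto simp: barrier_def min_def)
    then show ?thesis
      using smooth_pos_part_bounds(2)[OF s(1), of "z x"] unfolding w_min by linarith
  qed
  ultimately show ?thesis by (simp add: algebra_simps)
qed

text \<open>The known lower bound on \<open>u\<close> makes every slope with
  \<open>\<bar>p + a\<bar> \<ge> \<rho> + s * D\<close> violate the subsolution inequality.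
  Integrating the remaining slopes from 0 and from 1, where \<open>u \<le> 0\<close>, gives the two
  branches up to \<open>s * D\<close>.\<close>

lemma solution_le_barrier:
  assumes u: "viscosity_solution (F s) u" and s: "s > 0"
    and K: "K \<ge> 0" "\<And>x. x \<in> {0..1} \<Longrightarrow> \<bar>barrier x\<bar> \<le> K * \<rho> x"
    and C: "C \<ge> 0" "\<And>x. x \<in> {0..1} \<Longrightarrow> barrier x - s * C \<le> u x"
    and x: "x \<in> {0..1}"
  shows "u x \<le> barrier x + s * (K + C + 1)"
proof -
  \<comment> \<open>In the expansion of \<open>(\<rho> + s * D)\<^sup>2\<close>,
    \<open>D \<ge> K\<close> handles the term linear in \<open>\<rho>\<close> and
    \<open>2 * C < D * D\<close> the constant one.\<close>
  define D where "D = K + C + 1"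
  have D: "D > 0" "K \<le> D" using K C by (auto simp: D_def)
  have "2 * C < D * D"
  proof -
    have "(C + 1) * (C + 1) \<le> D * D" using K C by (intro mult_mono) (auto simp: D_def)
    moreover have "2 * C < (C + 1) * (C + 1)" using C by (simp add: algebra_simps add_pos_nonneg)
    ultimately show ?thesis by simp
  qed
  have sub: "viscosity_subsolution (F s) u" and cont: "continuous_on UNIV u"
    and per: "\<And>x. u (x + 1) = u x"
    using u by (auto simp: viscosity_solution_def periodic_fun_simple'_def)
  have u0: "u 0 \<le> 0" "u 1 \<le> 0"
    using solution_le[OF u s, of 0] per[of 0] by (auto simp: V_eq rho_0)
  have steep: "F s y (u y) p > 0" if y: "0 < y" "y < 1" and p: "\<rho> y + s * D \<le> \<bar>p + a\<bar>" for y p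
  proof -
    have "- u y \<le> K * \<rho> y + s * C"
      using K(2)[of y] C(2)[of y] y by auto
    also have "\<dots> \<le> D * \<rho> y + s * C"
      using D rho_nonneg[of y] by (simp add: mult_right_mono)
    finally have "s * (- u y) \<le> s * (D * \<rho> y + s * C)"
      using s by (intro mult_left_mono) auto
    moreover have "(\<rho> y + s * D)\<^sup>2 \<le> (p + a)\<^sup>2"
      using p rho_nonneg[of y] s D power_mono[of "\<rho> y + s * D" "\<bar>p + a\<bar>" 2] by simp
    moreover have "(\<rho> y + s * D)\<^sup>2 = (\<rho> y)\<^sup>2 + 2 * (s * (D * \<rho> y)) + s * s * (D * D)"
      by (simp add: power2_eq_square algebra_simps)
    moreover have "s * s * (2 * C) < s * s * (D * D)"
      using s \<open>2 * C < D * D\<close> by simp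
    ultimately show ?thesis unfolding F_eq by (simp add: algebra_simps diff_divide_distrib)
  qed
  have der: "((\<lambda>x. R x - a * x + s * D * x) has_real_derivative \<rho> y - a + s * D) (at y)"
       "((\<lambda>x. - R x - a * x - s * D * x) has_real_derivative - \<rho> y - a - s * D) (at y)" for y
    by (auto intro!: derivative_eq_intros R)
  have sDx: "s * D * x \<le> s * D * 1" "s * D * (1 - x) \<le> s * D * 1"
    using s D x by (intro mult_left_mono; simp)+
  have 1: "u x \<le> R x - a * x + s * D" if "x < 1"
  proof -
    have "u x - u 0 \<le> (R x - a * x + s * D * x) - (R 0 - a * 0 + s * D * 0)"
      using that x by (intro subsolution_increment_le_right[OF sub cont der(1), of 0 1])
        (auto intro!: continuous_intros continuous_rho steep)
    then show ?thesis using u0 sDx R_0 by simp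
  qed
  have 2: "u x \<le> R 1 - R x + a * (1 - x) + s * D" if "0 < x"
  proof -
    have "u x - u 1 \<le> (- R x - a * x - s * D * x) - (- R 1 - a * 1 - s * D * 1)"
      using that x by (intro subsolution_increment_le_left[OF sub cont der(2), of 0 1])
        (auto intro!: continuous_intros continuous_rho steep)
    then show ?thesis using u0 sDx by (simp add: algebra_simps)
  qed
  \<comment> \<open>Each increment bound excludes its far endpoint, so 0 and 1 are treated directly:
    there the barrier is 0 and \<open>u \<le> 0\<close>.\<close>
  have "u x \<le> barrier x + s * D"
  proof (cases "x = 0 \<or> x = 1")
    case True
    then have "barrier x = 0" using R_0 a_pos a_less by (auto simp: barrier_def)
    moreover have "0 \<le> s * D" using s D by simp
    ultimately show ?thesis using True u0 by auto
  next
    case False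
    then show ?thesis using 1 2 x by (auto simp: barrier_def)
  qed
  then show ?thesis by (simp add: D_def)
qed

text \<open>Both bounds place \<open>u s\<close> within a multiple of \<open>s\<close> of the
  barrier. This identifies \<open>u0\<close> with the barrier on [0,1], so the same estimate
  measures the distance to the limit.\<close>

lemma linear_rate:
  assumes u: "\<And>s. s > 0 \<Longrightarrow> viscosity_solution (F s) (u s)"
    and lim: "\<And>x. ((\<lambda>s. u s x) \<longlongrightarrow> u0 x) (at_right 0)"
    and "c > 0" and c: "\<And>x. x \<in> {0..1} \<Longrightarrow> c * min x (1 - x) \<le> \<rho> x"
  shows "\<exists>C>0. \<forall>\<^sub>F s in at_right 0. \<forall>x\<in>{0..1}. \<bar>u s x - u0 x\<bar> \<le> C * s"
proof -
  obtain K where K: "K \<ge> 0" "\<And>x. x \<in> {0..1} \<Longrightarrow> \<bar>barrier x\<bar> \<le> K * \<rho> x"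
    using barrier_le_rho[OF \<open>c > 0\<close> c] by blast
  define C where "C = K\<^sup>2 + K + 1"
  have C: "C \<ge> 0" "C > 0" using K by (auto simp: C_def add_nonneg_pos)
  define d where "d = (R 1 - a) / (K + 1)"
  have "d > 0" using a_less K by (simp add: d_def)
  then have "\<forall>\<^sub>F s in at_right 0. s \<in> {0<..<d}"
    using eventually_at_right_real by blast
  then have ev: "\<forall>\<^sub>F s in at_right 0. \<forall>x\<in>{0..1}. \<bar>u s x - barrier x\<bar> \<le> (K + C + 1) * s"
  proof (rule eventually_mono)
    fix s assume s: "s \<in> {0<..<d}"
    then have "s * (K + 1) < R 1 - a"
      using K by (simp add: d_def field_simps)
    then have ge: "barrier x - s * C \<le> u s x" if "x \<in> {0..1}" for x
      unfolding C_def using s that K by (intro solution_ge_barrier[OF u]) auto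
    show "\<forall>x\<in>{0..1}. \<bar>u s x - barrier x\<bar> \<le> (K + C + 1) * s"
    proof
      fix x :: real assume x: "x \<in> {0..1}"
      have "u s x \<le> barrier x + s * (K + C + 1)"
        using s x K C ge by (intro solution_le_barrier[OF u]) auto
      moreover have "s * C \<le> s * (K + C + 1)" using s K by (intro mult_left_mono) auto
      ultimately show "\<bar>u s x - barrier x\<bar> \<le> (K + C + 1) * s"
        using ge[OF x] by (simp add: abs_le_iff mult.commute)
    qed
  qed
  have "u0 x = barrier x" if x: "x \<in> {0..1}" for x
  proof -
    have "((\<lambda>s. u s x - barrier x) \<longlongrightarrow> 0) (at_right 0)"
    proof (rule Lim_null_comparison)
      show "\<forall>\<^sub>F s in at_right 0. norm (u s x - barrier x) \<le> (K + C + 1) * s"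
        using ev by (rule eventually_mono) (use x in auto)
      show "((\<lambda>s. (K + C + 1) * s) \<longlongrightarrow> 0) (at_right 0)"
        by (auto intro!: tendsto_eq_intros)
    qed
    then have "((\<lambda>s. u s x) \<longlongrightarrow> barrier x) (at_right 0)"
      by (simp add: LIM_zero_iff)
    then show ?thesis
      using tendsto_unique[OF _ lim] by auto
  qed
  with ev show ?thesis
    using K C by (intro exI[of _ "K + C + 1"]) (auto elim!: eventually_mono)
qed

end

section \<open>Rates in the supremum norm\<close>

text \<open>The bound \<open>B\<close> certifies that the supremum is over a bounded set; its size
  is irrelevant.\<close>

lemma sup_norm_ge:
  assumes "\<And>x. \<bar>f x\<bar> \<le> B"
  shows "\<bar>f x\<bar> \<le> sup_norm f"
  unfolding sup_norm_def using assms by (intro cSUP_upper) (auto simp: bdd_above_def)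

lemma sup_norm_le:
  assumes "\<And>x. \<bar>f x\<bar> \<le> B"
  shows "sup_norm f \<le> B"
  unfolding sup_norm_def using assms by (intro cSUP_least) auto

lemma powr_not_bigo_id:
  fixes g :: "real \<Rightarrow> real"
  assumes "C > 0" "\<alpha> < 1" and g: "\<forall>\<^sub>F s in at_right 0. C * s powr \<alpha> \<le> g s"
  shows "g \<notin> O[at_right 0](\<lambda>s. s)"
proof
  assume "g \<in> O[at_right 0](\<lambda>s. s)"
  then obtain c where c: "c > 0" "\<forall>\<^sub>F s in at_right 0. norm (g s) \<le> c * norm s"
    by (rule landau_o.bigE)
  have "((\<lambda>s. s powr (1 - \<alpha>)) \<longlongrightarrow> 0) (at_right 0)"
    using \<open>\<alpha> < 1\<close> by (intro tendsto_zero_powrI[where b = "1 - \<alpha>"])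
      (auto intro!: eventually_at_rightI[of 0 1] tendsto_eq_intros)
  then have "\<forall>\<^sub>F s in at_right 0. s powr (1 - \<alpha>) < C / c"
    using c \<open>C > 0\<close> by (intro order_tendstoD(2)) auto
  moreover have "\<forall>\<^sub>F s::real in at_right 0. s > 0"
    by (rule eventually_at_right_less)
  ultimately have "\<forall>\<^sub>F s::real in at_right 0. False"
    using g c(2)
  proof eventually_elim
    case (elim s)
    have "c * s powr (1 - \<alpha>) * s powr \<alpha> < C * s powr \<alpha>"
      using elim c(1) by (intro mult_strict_right_mono) (auto simp: field_simps)
    moreover have "c * s powr (1 - \<alpha>) * s powr \<alpha> = c * s"
      using elim by (simp flip: powr_add)
    ultimately show False using elim by auto
  qed
  then show False by (simp add: eventually_False trivial_limit_at_right_real)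
qed

text \<open>Near the endpoints the bound is \<open>near\<close>; in between, compactness gives a
  positive minimum of \<open>\<rho>\<close>, while \<open>min x (1 - x)\<close> is at most
  1.\<close>

lemma quadratic_zero_imp_ge_dist:
  fixes \<rho> :: "real \<Rightarrow> real"
  assumes cont: "continuous_on UNIV \<rho>" and pos: "\<And>x. 0 < x \<Longrightarrow> x < 1 \<Longrightarrow> 0 < \<rho> x"
    and "\<delta> > 0" and near: "\<And>t. 0 \<le> t \<Longrightarrow> t < \<delta> \<Longrightarrow> t \<le> \<rho> t \<and> t \<le> \<rho> (1 - t)"
  shows "\<exists>c>0. \<forall>x\<in>{0..1}. c * min x (1 - x) \<le> \<rho> x"
proof -
  define d where "d = min (\<delta> / 2) (1 / 4)"
  have d: "0 < d" "d < \<delta>" "d \<le> 1/4" using \<open>\<delta> > 0\<close> by (auto simp: d_def)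
  obtain y where y: "y \<in> {d..1 - d}" "\<And>x. x \<in> {d..1 - d} \<Longrightarrow> \<rho> y \<le> \<rho> x"
    using continuous_attains_inf[of "{d..1 - d}" \<rho>] continuous_on_subset[OF cont] d by force
  have "\<rho> y > 0" using y(1) d by (intro pos) auto
  define c where "c = min 1 (\<rho> y)"
  have c: "0 < c" "c \<le> 1" "c \<le> \<rho> y" using \<open>\<rho> y > 0\<close> by (auto simp: c_def)
  have "c * min x (1 - x) \<le> \<rho> x" if x: "x \<in> {0..1}" for x
  proof -
    have le: "c * min x (1 - x) \<le> min x (1 - x)" "c * min x (1 - x) \<le> c"
      using c x mult_right_mono[of c 1 "min x (1 - x)"] mult_left_mono[of "min x (1 - x)" 1 c] by auto
    consider "x < d" | "1 - x < d" | "x \<in> {d..1 - d}" using d by force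
    then show ?thesis
    proof cases
      case 1
      then show ?thesis using near[of x] le x d by auto
    next
      case 2
      then show ?thesis using near[of "1 - x"] le x d by auto
    next
      case 3
      then show ?thesis using y(2)[OF 3] le c by linarith
    qed
  qed
  then show ?thesis using c by blast
qed

theorem proposition5p1:
  fixes r :: nat and V :: "real \<Rightarrow> real" and a :: real
    and u :: "real \<Rightarrow> real \<Rightarrow> real" and u0 :: "real \<Rightarrow> real"
  assumes "r \<ge> 1"
    and "periodic_fun_simple' V"
    and "smooth V"
    and "\<forall>x. V x \<le> 0"
    and "\<forall>x. V x = 0 \<longleftrightarrow> x \<in> \<int>"
    and "\<exists>\<delta>>0. \<forall>x. \<bar>x\<bar> < \<delta> \<longrightarrow> V x = - (x ^ (2 * r))"
    and "\<exists>m. {x \<in> {0<..<1}. deriv V x = 0} = {m} \<and>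
             (\<forall>\<^sub>F y in nhds m. V m \<le> V y) \<and> deriv (deriv V) m \<noteq> 0"
    and "0 < a" and "a < integral {0..1} (\<lambda>x. sqrt (- 2 * V x))"
    and "\<forall>s>0. viscosity_solution (\<lambda>x z p. s * z + hamiltonian V a x p) (u s)"
    and "uniform_limit UNIV u u0 (at_right 0)"
  shows "(\<exists>C>0. \<forall>\<^sub>F s in at_right 0.
            sup_norm (\<lambda>x. u s x - u0 x) \<ge> C * s powr (1 / (2 * real r - 1)))
       \<and> (r = 1 \<longrightarrow> asymp_at_zero (\<lambda>s. sup_norm (\<lambda>x. u s x - u0 x)) (\<lambda>s. s))
       \<and> (r \<ge> 2 \<longrightarrow> (\<lambda>s. sup_norm (\<lambda>x. u s x - u0 x)) \<notin> O[at_right 0](\<lambda>s. s))"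
proof -
  define \<rho> where "\<rho> x = sqrt (- 2 * V x)" for x
  define N where "N s = sup_norm (\<lambda>x. u s x - u0 x)" for s
  define \<alpha> where "\<alpha> = 1 / (2 * real r - 1)"
  have "((deriv ^^ 0) V) differentiable_on UNIV"
    using \<open>smooth V\<close> unfolding smooth_def by blast
  then have "continuous_on UNIV V"
    by (simp add: differentiable_imp_continuous_on)
  then have cont: "continuous_on UNIV \<rho>"
    unfolding \<rho>_def by (intro continuous_intros)
  obtain R where R_0: "R 0 = 0" and R: "\<And>x. (R has_real_derivative \<rho> x) (at x)"
    using antiderivative_exists[OF cont] by blast
  have "(\<rho> has_integral (R 1 - R 0)) {0..1}"
    using R by (intro fundamental_theorem_of_calculus)
      (auto simp: has_real_derivative_iff_has_vector_derivative[symmetric] intro: has_field_derivative_at_within)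
  then have R_1: "R 1 = integral {0..1} (\<lambda>x. sqrt (- 2 * V x))"
    using R_0 by (simp add: integral_unique \<rho>_def[abs_def])
  have "x \<notin> \<int>" if "0 < x" "x < 1" for x :: real
    using that by (auto elim!: Ints_cases)
  interpret discounted_potential V \<rho> R a
  proof
    show "V x = - (\<rho> x)\<^sup>2 / 2" for x using assms(4) by (simp add: \<rho>_def)
    show "0 \<le> \<rho> x" for x using assms(4) by (simp add: \<rho>_def)
    show "0 < \<rho> x" if "0 < x" "x < 1" for x
      using assms(4,5) that \<open>\<And>x. 0 < x \<Longrightarrow> x < 1 \<Longrightarrow> x \<notin> \<int>\<close>
      by (simp add: \<rho>_def order.strict_iff_order)
    show "\<rho> 0 = 0" "\<rho> 1 = 0" using assms(5) by (auto simp: \<rho>_def)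
    show "a < R 1" using assms(9) by (simp add: R_1)
  qed (use cont R R_0 \<open>0 < a\<close> in auto)
  have sol: "viscosity_solution (F s) (u s)" if "s > 0" for s
    using assms(10) that by (simp add: F_def[abs_def])
  have lim: "((\<lambda>s. u s x) \<longlongrightarrow> u0 x) (at_right 0)" for x
    using tendsto_uniform_limitI[OF assms(11)] by simp
  obtain \<delta> where \<delta>: "\<delta> > 0" "\<And>x. \<bar>x\<bar> < \<delta> \<Longrightarrow> V x = - (x ^ (2 * r))"
    using assms(6) by blast
  interpret V: periodic_fun_simple' V by fact
  \<comment> \<open>Periodicity carries the normal form from 0 to 1, and the even exponent removes
    the sign.\<close>
  have V1: "V (1 - t) = - (t ^ (2 * r))" if "0 \<le> t" "t < \<delta>" for t
    using \<delta>(2)[of "-t"] V.plus_period[of "-t"] that by simp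
  have pos: "\<forall>\<^sub>F s::real in at_right 0. s > 0"
    by (rule eventually_at_right_less)
  \<comment> \<open>The tolerance 1 is arbitrary: it bounds the difference, so that
    \<open>N s\<close> is a genuine supremum.\<close>
  have "\<forall>\<^sub>F s in at_right 0. \<forall>x\<in>UNIV. dist (u s x) (u0 x) < 1"
    using uniform_limitD[OF assms(11)] by simp
  then have N_ge: "\<forall>\<^sub>F s in at_right 0. \<forall>x. \<bar>u s x - u0 x\<bar> \<le> N s"
  proof (rule eventually_mono)
    fix s assume "\<forall>x\<in>UNIV. dist (u s x) (u0 x) < 1"
    then have "\<bar>u s x - u0 x\<bar> \<le> 1" for x
      by (simp add: dist_real_def less_imp_le)
    then show "\<forall>x. \<bar>u s x - u0 x\<bar> \<le> N s"
      unfolding N_def using sup_norm_ge[of "\<lambda>x. u s x - u0 x"] by blast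
  qed
  obtain C where C: "C > 0" "\<forall>\<^sub>F s in at_right 0. \<exists>x. C * s powr \<alpha> \<le> u0 x - u s x"
    using limit_gap[OF sol lim \<open>r \<ge> 1\<close> \<delta>(1) V1] unfolding \<alpha>_def by blast
  from C(2) N_ge have lower: "\<forall>\<^sub>F s in at_right 0. C * s powr \<alpha> \<le> N s"
  proof eventually_elim
    case (elim s)
    then obtain x where "C * s powr \<alpha> \<le> u0 x - u s x" by blast
    moreover have "u0 x - u s x \<le> N s" using elim(2) by (simp add: abs_le_iff)
    ultimately show ?case by linarith
  qed
  moreover have "asymp_at_zero N (\<lambda>s. s)" if "r = 1"
  proof -
    \<comment> \<open>For \<open>r = 1\<close> the function \<open>\<rho>\<close> equals
      \<open>sqrt 2 * t\<close> at distance \<open>t\<close> from its zeros.\<close>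
    have "t \<le> \<rho> t \<and> t \<le> \<rho> (1 - t)" if "0 \<le> t" "t < \<delta>" for t
    proof -
      have "t = sqrt (t\<^sup>2)" using that by simp
      also have "\<dots> \<le> sqrt (2 * t\<^sup>2)" by (intro real_sqrt_le_mono) simp
      finally show ?thesis
        using \<delta>(2)[of t] V1[of t] that \<open>r = 1\<close> by (simp add: \<rho>_def)
    qed
    then obtain c where c: "c > 0" "\<And>x. x \<in> {0..1} \<Longrightarrow> c * min x (1 - x) \<le> \<rho> x"
      using quadratic_zero_imp_ge_dist[OF cont rho_pos \<delta>(1)] by blast
    obtain D where D: "D > 0" "\<forall>\<^sub>F s in at_right 0. \<forall>x\<in>{0..1}. \<bar>u s x - u0 x\<bar> \<le> D * s"
      using linear_rate[OF sol lim c] by blast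
    have per: "periodic_fun_simple' (u s)" if "s > 0" for s
      using sol[OF that] by (simp add: viscosity_solution_def)
    \<comment> \<open>Periodicity of the limit extends the estimate from [0,1] to the whole line
      through \<open>frac\<close>.\<close>
    have per0: "u0 (x + 1) = u0 x" for x
    proof (rule tendsto_unique[OF _ lim[of "x + 1"]])
      have "\<forall>\<^sub>F s in at_right 0. u s x = u s (x + 1)"
        using pos by (rule eventually_mono) (use per in \<open>simp add: periodic_fun_simple'_def\<close>)
      then show "((\<lambda>s. u s (x + 1)) \<longlongrightarrow> u0 x) (at_right 0)"
        by (rule Lim_transform_eventually[OF lim[of x]])
    qed simp
    from D(2) pos have upper: "\<forall>\<^sub>F s in at_right 0. N s \<le> D * s"
    proof eventually_elim
      case (elim s)
      show ?case unfolding N_def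
      proof (rule sup_norm_le)
        fix x :: real
        interpret us: periodic_fun_simple' "u s" using per elim by simp
        interpret u0: periodic_fun_simple' u0 by standard (rule per0)
        have "frac x \<in> {0..1}" using frac_lt_1[of x] by (simp add: less_imp_le)
        then have "\<bar>u s (frac x) - u0 (frac x)\<bar> \<le> D * s" using elim by blast
        then show "\<bar>u s x - u0 x\<bar> \<le> D * s"
          by (simp add: frac_def us.minus_of_int u0.minus_of_int)
      qed
    qed
    define B where "B = max 1 (max D (inverse C))"
    have B: "1 \<le> B" "D \<le> B" "inverse B \<le> C"
      using \<open>C > 0\<close> le_imp_inverse_le[of "inverse C" B] by (auto simp: B_def)
    from lower upper pos have "\<forall>\<^sub>F s in at_right 0. inverse B * s \<le> N s \<and> N s \<le> B * s"
    proof eventually_elim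
      case (elim s)
      have "inverse B * s \<le> C * s" "D * s \<le> B * s"
        using B elim by (auto intro: mult_right_mono)
      moreover have "C * s \<le> N s" using elim \<open>r = 1\<close> by (simp add: \<alpha>_def)
      ultimately show ?case using elim by linarith
    qed
    then show ?thesis unfolding asymp_at_zero_def using B by blast
  qed
  \<comment> \<open>For \<open>r \<ge> 2\<close> the exponent \<alpha> is at most 1/3, so the lower
    rate exceeds every multiple of \<open>s\<close>.\<close>
  moreover have "N \<notin> O[at_right 0](\<lambda>s. s)" if "r \<ge> 2"
    using that by (intro powr_not_bigo_id[OF C(1) _ lower]) (simp add: \<alpha>_def)
  ultimately show ?thesis
    using C(1) unfolding N_def[abs_def] \<alpha>_def by blast
qed

end
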